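(* Let $a,b,p,q\in\mathbb{Z}$, let $(w_n)_{n\ge 0}$ be the Horadam sequence $w_0=a$, $w_1=b$, $w_n=p\,w_{n-1}+q\,w_{n-2}$ for $n\ge 2$, and let $BH_n=w_n+w_{n+1}i+w_{n+2}j+w_{n+3}k\in\mathbb{BC}$ be the $n$th bicomplex Horadam number. Let $\alpha=\frac{p+\sqrt{p^2+4q}}{2}$ and $\beta=\frac{p-\sqrt{p^2+4q}}{2}$ be the roots of the characteristic equation $t^2-pt-q=0$, and set $A=b-a\beta$, $B=b-a\alpha$, $\underline{\alpha}=1+\alpha i+\alpha^2 j+\alpha^3 k$, $\underline{\beta}=1+\beta i+\beta^2 j+\beta^3 k$. Then the Binet formula for the $n$th bicomplex Horadam number is $$BH_n=\frac{A\,\underline{\alpha}\,\alpha^n-B\,\underline{\beta}\,\beta^n}{\alpha-\beta}.$$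
   Context: $\mathbb{BC}=\{z_1+z_2 j : z_1,z_2\in\mathbb{C}\}$ is the algebra of bicomplex numbers: the commutative associative real algebra with basis $1,i,j,k$, where $i^2=j^2=-1$, $ij=ji=k$, $k^2=1$, $ik=ki=-j$, $jk=kj=-i$. *)

theory Defs
  imports Complex_Main
begin

(* z1 + z2 j is represented by BC z1 z2; the coefficient field is C = R(i). *)
datatype bicomplex = BC (bc_fst: complex) (bc_snd: complex)

lemma bicomplex_eq_iff: "x = y \<longleftrightarrow> bc_fst x = bc_fst y \<and> bc_snd x = bc_snd y"
  by (cases x; cases y) simp

instantiation bicomplex :: real_algebra_1
begin

definition "0 = BC 0 0"
definition "1 = BC 1 0"
definition "x + y = BC (bc_fst x + bc_fst y) (bc_snd x + bc_snd y)"
definition "- x = BC (- bc_fst x) (- bc_snd x)"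
definition "x - y = BC (bc_fst x - bc_fst y) (bc_snd x - bc_snd y)" for x y :: bicomplex
definition "x * y =
  BC (bc_fst x * bc_fst y - bc_snd x * bc_snd y) (bc_fst x * bc_snd y + bc_snd x * bc_fst y)"
definition "r *\<^sub>R x = BC (r *\<^sub>R bc_fst x) (r *\<^sub>R bc_snd x)"

instance
  by standard
    (simp_all add: bicomplex_eq_iff zero_bicomplex_def one_bicomplex_def plus_bicomplex_def
      uminus_bicomplex_def minus_bicomplex_def times_bicomplex_def scaleR_bicomplex_def
      algebra_simps)

end

instance bicomplex :: comm_ring_1
proof
  fix x y :: bicomplex
  show "x * y = y * x"
    by (simp add: times_bicomplex_def mult.commute add.commute)
qed (simp_all add: distrib_right)

definition bc_i :: bicomplex where "bc_i = BC \<i> 0"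
definition bc_j :: bicomplex where "bc_j = BC 0 1"
definition bc_k :: bicomplex where "bc_k = BC 0 \<i>"

lemma bicomplex_basis_mult:
  "bc_i * bc_i = - 1" "bc_j * bc_j = - 1" "bc_k * bc_k = 1"
  "bc_i * bc_j = bc_k" "bc_j * bc_i = bc_k"
  "bc_i * bc_k = - bc_j" "bc_k * bc_i = - bc_j"
  "bc_j * bc_k = - bc_i" "bc_k * bc_j = - bc_i"
  by (simp_all add: bicomplex_eq_iff bc_i_def bc_j_def bc_k_def times_bicomplex_def
      uminus_bicomplex_def one_bicomplex_def)

lemma bicomplex_basis:
  "\<exists>!(r, s, t, u). x = of_real r + of_real s * bc_i + of_real t * bc_j + of_real u * bc_k"
proof -
  have "(x = of_real r + of_real s * bc_i + of_real t * bc_j + of_real u * bc_k) \<longleftrightarrow>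
      r = Re (bc_fst x) \<and> s = Im (bc_fst x) \<and> t = Re (bc_snd x) \<and> u = Im (bc_snd x)" for r s t u
    unfolding bicomplex_eq_iff bc_i_def bc_j_def bc_k_def times_bicomplex_def of_real_def
      plus_bicomplex_def scaleR_bicomplex_def one_bicomplex_def complex_eq_iff
    by (simp, linarith)
  then show ?thesis by auto
qed

(* BC has zero divisors, so it is not a field. The inverse is
   (z1 - z2 j) / (z1^2 + z2^2) when z1^2 + z2^2 is nonzero, i.e. when z1 + z2 j is a unit,
   and 0 for all non-units. *)
instantiation bicomplex :: inverse
begin

definition "inverse x =
  BC (bc_fst x / ((bc_fst x)\<^sup>2 + (bc_snd x)\<^sup>2)) (- bc_snd x / ((bc_fst x)\<^sup>2 + (bc_snd x)\<^sup>2))"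
definition "x div y = x * inverse y" for x y :: bicomplex

instance ..

end

lemma bicomplex_right_inverse:
  assumes "x dvd (1 :: bicomplex)"
  shows "x * inverse x = 1"
proof -
  obtain y where y: "1 = x * y" using assms by (rule dvdE)
  have "((bc_fst x)\<^sup>2 + (bc_snd x)\<^sup>2) * ((bc_fst y)\<^sup>2 + (bc_snd y)\<^sup>2)
      = (bc_fst (x * y))\<^sup>2 + (bc_snd (x * y))\<^sup>2"
    by (simp add: times_bicomplex_def power2_eq_square algebra_simps)
  also have "\<dots> = 1" by (simp add: y [symmetric] one_bicomplex_def)
  finally have "(bc_fst x)\<^sup>2 + (bc_snd x)\<^sup>2 \<noteq> 0" by auto
  then show ?thesis
    by (simp add: bicomplex_eq_iff times_bicomplex_def inverse_bicomplex_def one_bicomplex_def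
        power2_eq_square add_divide_distrib [symmetric])
qed

definition bc_of_complex :: "complex \<Rightarrow> bicomplex" where
  "bc_of_complex z = BC z 0"

fun horadam :: "int \<Rightarrow> int \<Rightarrow> int \<Rightarrow> int \<Rightarrow> nat \<Rightarrow> int" where
  "horadam a b p q 0 = a"
| "horadam a b p q (Suc 0) = b"
| "horadam a b p q (Suc (Suc n)) = p * horadam a b p q (Suc n) + q * horadam a b p q n"

definition bicomplex_horadam :: "int \<Rightarrow> int \<Rightarrow> int \<Rightarrow> int \<Rightarrow> nat \<Rightarrow> bicomplex" where
  "bicomplex_horadam a b p q n =
     of_int (horadam a b p q n)
     + of_int (horadam a b p q (n + 1)) * bc_i
     + of_int (horadam a b p q (n + 2)) * bc_j
     + of_int (horadam a b p q (n + 3)) * bc_k"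

end

theory Submission
  imports Defs
begin

text \<open>The scalar Binet formula holds for every Horadam number over \<open>\<complex>\<close>; it is carried into the
  bicomplex numbers by the ring embedding \<open>z \<mapsto> z + 0 j\<close> and applied to each of the four
  basis coefficients. The embedding sends the nonzero number \<open>\<alpha> - \<beta>\<close> to a unit, so the division
  in the zero-divisor ring is legitimate.\<close>

lemma bc_of_complex_1 [simp]: "bc_of_complex 1 = 1"
  by (simp add: bc_of_complex_def one_bicomplex_def)

lemma bc_of_complex_diff: "bc_of_complex (x - y) = bc_of_complex x - bc_of_complex y"
  by (simp add: bc_of_complex_def minus_bicomplex_def)

lemma bc_of_complex_mult: "bc_of_complex (x * y) = bc_of_complex x * bc_of_complex y"
  by (simp add: bc_of_complex_def times_bicomplex_def)

lemma bc_of_complex_power: "bc_of_complex (x ^ n) = bc_of_complex x ^ n"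
  by (induction n) (simp_all add: bc_of_complex_mult)

lemma bc_of_complex_of_real: "bc_of_complex (of_real r) = of_real r"
  by (simp add: bc_of_complex_def of_real_def scaleR_bicomplex_def one_bicomplex_def)

lemma bc_of_complex_of_int: "bc_of_complex (of_int m) = of_int m"
  using bc_of_complex_of_real [of "of_int m"] by simp

text \<open>This trades the quotient for an identity free of division. The total
  \<open>inverse\<close> is 0 at non-units, so cancelling requires a unit; the image of the complex
  inverse of \<open>z\<close> witnesses that.\<close>

lemma bc_divide_of_complex:
  assumes "z \<noteq> 0" and "x * bc_of_complex z = y"
  shows "x = y / bc_of_complex z"
proof -
  have "bc_of_complex z * bc_of_complex (inverse z) = 1"
    using assms(1) by (simp flip: bc_of_complex_mult)
  then have "bc_of_complex z dvd 1"
    by (metis dvdI)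
  then have "bc_of_complex z * inverse (bc_of_complex z) = 1"
    by (rule bicomplex_right_inverse)
  then show ?thesis
    unfolding divide_bicomplex_def assms(2) [symmetric] by (simp add: mult.assoc)
qed

text \<open>Both sides obey the same second-order recurrence in \<open>n\<close> and agree at 0 and
  1. Keeping the factor \<open>\<alpha> - \<beta>\<close> on the left avoids division, so any
  commutative ring will do.\<close>

lemma horadam_Binet:
  fixes \<alpha> \<beta> :: "'a::comm_ring_1"
  assumes "\<alpha>\<^sup>2 = of_int p * \<alpha> + of_int q" and "\<beta>\<^sup>2 = of_int p * \<beta> + of_int q"
  shows "of_int (horadam a b p q n) * (\<alpha> - \<beta>) =
    (of_int b - of_int a * \<beta>) * \<alpha> ^ n - (of_int b - of_int a * \<alpha>) * \<beta> ^ n"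
proof (induction n rule: induct_nat_012)
  case 0
  show ?case by (simp add: algebra_simps)
next
  case 1
  show ?case by (simp add: algebra_simps)
next
  case (ge2 n)
  \<comment> \<open>The powers of a root form a solution of the recurrence: multiply the
    characteristic equation by \<open>x ^ n\<close>.\<close>
  have step: "x ^ Suc (Suc n) = of_int p * x ^ Suc n + of_int q * x ^ n"
    if "x\<^sup>2 = of_int p * x + of_int q" for x :: 'a
  proof -
    have "x ^ Suc (Suc n) = x\<^sup>2 * x ^ n" by (simp add: power2_eq_square mult.assoc)
    then show ?thesis by (simp add: that algebra_simps)
  qed
  have "of_int (horadam a b p q (Suc (Suc n))) * (\<alpha> - \<beta>) =
      of_int p * (of_int (horadam a b p q (Suc n)) * (\<alpha> - \<beta>))
      + of_int q * (of_int (horadam a b p q n) * (\<alpha> - \<beta>))"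
    by (simp add: distrib_right mult.assoc)
  then show ?case
    unfolding ge2.IH step [OF assms(1)] step [OF assms(2)]
    by (simp only: ring_distribs mult.assoc mult.left_commute) (simp add: algebra_simps)
qed

theorem theorem3p1:
  fixes a b p q :: int and n :: nat
    and \<alpha> \<beta> A B :: complex
    and \<alpha>' \<beta>' :: bicomplex
  assumes "p\<^sup>2 + 4 * q \<noteq> 0"
    and "\<alpha> = (of_int p + csqrt (of_int (p\<^sup>2 + 4 * q))) / 2"
    and "\<beta> = (of_int p - csqrt (of_int (p\<^sup>2 + 4 * q))) / 2"
    and "A = of_int b - of_int a * \<beta>"
    and "B = of_int b - of_int a * \<alpha>"
    and "\<alpha>' = 1 + bc_of_complex \<alpha> * bc_i + bc_of_complex \<alpha> ^ 2 * bc_j + bc_of_complex \<alpha> ^ 3 * bc_k"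
    and "\<beta>' = 1 + bc_of_complex \<beta> * bc_i + bc_of_complex \<beta> ^ 2 * bc_j + bc_of_complex \<beta> ^ 3 * bc_k"
  shows "bicomplex_horadam a b p q n =
    (bc_of_complex A * \<alpha>' * bc_of_complex \<alpha> ^ n - bc_of_complex B * \<beta>' * bc_of_complex \<beta> ^ n)
      / bc_of_complex (\<alpha> - \<beta>)"
proof (rule bc_divide_of_complex)
  \<comment> \<open>Only two facts about this root of the discriminant enter: its square and
    \<open>s \<noteq> 0\<close>. The branch chosen by \<open>csqrt\<close> is immaterial.\<close>
  define s where "s = csqrt (of_int (p\<^sup>2 + 4 * q))"
  have s2: "s\<^sup>2 = (of_int p)\<^sup>2 + 4 * of_int q"
    by (simp add: s_def)
  have \<alpha>: "\<alpha> = (of_int p + s) / 2" and \<beta>: "\<beta> = (of_int p - s) / 2"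
    using assms(2,3) by (simp_all add: s_def)
  have "s \<noteq> 0"
    using assms(1) by (simp only: s_def csqrt_eq_0 of_int_eq_0_iff) simp
  \<comment> \<open>The difference of the roots is exactly \<open>s\<close>.\<close>
  then show "\<alpha> - \<beta> \<noteq> 0"
    by (simp add: \<alpha> \<beta> field_simps)
  have "\<alpha>\<^sup>2 = of_int p * \<alpha> + of_int q" "\<beta>\<^sup>2 = of_int p * \<beta> + of_int q"
    using s2 by (simp_all add: \<alpha> \<beta> power2_eq_square field_simps)
  then have "of_int (horadam a b p q m) * (\<alpha> - \<beta>) = A * \<alpha> ^ m - B * \<beta> ^ m" for m
    unfolding assms(4,5) by (rule horadam_Binet)
  then have "bc_of_complex (of_int (horadam a b p q m) * (\<alpha> - \<beta>)) =
      bc_of_complex (A * \<alpha> ^ m - B * \<beta> ^ m)" for m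
    by simp
  then have w: "of_int (horadam a b p q m) * bc_of_complex (\<alpha> - \<beta>) =
      bc_of_complex A * bc_of_complex \<alpha> ^ m - bc_of_complex B * bc_of_complex \<beta> ^ m" for m
    by (simp only: bc_of_complex_mult bc_of_complex_of_int bc_of_complex_diff bc_of_complex_power)
  \<comment> \<open>Distributing the factor over the four terms brings each coefficient into the
    form of the left side of \<open>w\<close>, with \<open>m\<close> running from \<open>n\<close>
    to \<open>n + 3\<close>.\<close>
  have "bicomplex_horadam a b p q n * bc_of_complex (\<alpha> - \<beta>) =
      of_int (horadam a b p q n) * bc_of_complex (\<alpha> - \<beta>)
      + of_int (horadam a b p q (n + 1)) * bc_of_complex (\<alpha> - \<beta>) * bc_i
      + of_int (horadam a b p q (n + 2)) * bc_of_complex (\<alpha> - \<beta>) * bc_j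
      + of_int (horadam a b p q (n + 3)) * bc_of_complex (\<alpha> - \<beta>) * bc_k"
    unfolding bicomplex_horadam_def by (simp only: distrib_left distrib_right mult_ac)
  also have "\<dots> =
      bc_of_complex A * \<alpha>' * bc_of_complex \<alpha> ^ n - bc_of_complex B * \<beta>' * bc_of_complex \<beta> ^ n"
    \<comment> \<open>Splitting the exponents as \<open>n\<close> plus 0, 1, 2, 3 lets the
      \<open>n\<close>th powers of the roots factor out; the remaining sums over the basis are
      \<open>\<alpha>'\<close> and \<open>\<beta>'\<close>.\<close>
    unfolding w assms(6,7) power_add by (simp add: algebra_simps)
  finally show "bicomplex_horadam a b p q n * bc_of_complex (\<alpha> - \<beta>) =
      bc_of_complex A * \<alpha>' * bc_of_complex \<alpha> ^ n - bc_of_complex B * \<beta>' * bc_of_complex \<beta> ^ n" .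
qed

end
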